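(* Let $\theta$ be the positive real root of $x^4-x^3-1=0$. Then $$\operatorname{Li}_2\left(\frac{1}{\theta^{14}}\right)-2\operatorname{Li}_2\left(\frac{1}{\theta^{7}}\right)-2\operatorname{Li}_2\left(\frac{1}{\theta^{5}}\right)+\operatorname{Li}_2\left(\frac{1}{\theta^{4}}\right)+2\operatorname{Li}_2\left(\frac{1}{\theta^{2}}\right)+2\operatorname{Li}_2\left(\frac{1}{\theta}\right)=\frac{\pi^2}{3}-5\log^2\left(\frac1\theta\right).$$
   Context: $\operatorname{Li}_2(z)=\sum_{k\ge1}z^k/k^2$ for $|z|\le 1$ is the dilogarithm; $\log$ is the natural logarithm and $\log^2(y)=(\log y)^2$. The polynomial $x^4-x^3-1$ has exactly one positive real root (it is the second smallest Pisot number, $\theta\approx1.3803$). *)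

theory Defs
  imports "HOL-Analysis.Analysis"
begin

(* Index shifted by one (k = Suc n). Meaningful only for norm z <= 1, where the series converges. *)
definition Li2 :: "'a :: {real_normed_field, banach} \<Rightarrow> 'a" where
  "Li2 z = (\<Sum>n. z ^ Suc n / of_nat (Suc n) ^ 2)"

lemma Li2_sums:
  fixes z :: "'a :: {real_normed_field, banach}"
  assumes "norm z \<le> 1"
  shows "(\<lambda>n. z ^ Suc n / of_nat (Suc n) ^ 2) sums Li2 z"
proof -
  have s: "summable (\<lambda>n. 1 / real (Suc n) ^ 2)"
    using inverse_power_summable[of 2, where 'a = real]
    by (subst summable_Suc_iff) (simp add: field_simps)
  have "summable (\<lambda>n. z ^ Suc n / of_nat (Suc n) ^ 2)"
  proof (rule summable_comparison_test'[OF s, of 0])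
    fix n :: nat
    have "norm z ^ Suc n \<le> 1"
      using assms by (intro power_le_one) auto
    then show "norm (z ^ Suc n / of_nat (Suc n) ^ 2) \<le> 1 / real (Suc n) ^ 2"
      by (simp only: norm_divide norm_power norm_of_nat) (rule divide_right_mono, auto)
  qed
  then show ?thesis
    unfolding Li2_def by (rule summable_sums)
qed

lemma ex1_theta: "\<exists>!\<theta>::real. \<theta> > 0 \<and> \<theta> ^ 4 - \<theta> ^ 3 - 1 = 0"
proof -
  have "\<exists>x\<ge>1. x \<le> 2 \<and> x ^ 4 - x ^ 3 - 1 = (0::real)"
    by (rule IVT') (auto intro!: continuous_intros)
  then obtain t :: real where t: "1 \<le> t" "t ^ 4 - t ^ 3 - 1 = 0"
    by blast
  have less: False if "0 < x" "x < y" "x ^ 4 - x ^ 3 - 1 = 0" "y ^ 4 - y ^ 3 - 1 = 0" for x y :: real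
  proof -
    have x: "x ^ 3 * (x - 1) = 1" and y: "y ^ 3 * (y - 1) = 1"
      using that(3,4) by (simp_all add: algebra_simps power_numeral_reduce)
    from x that(1) have "x > 1"
      by (metis diff_gt_0_iff_gt zero_less_mult_pos zero_less_one zero_less_power)
    then have "x ^ 3 * (x - 1) < y ^ 3 * (y - 1)"
      using that(2) by (intro mult_strict_mono power_strict_mono) auto
    with x y show False by simp
  qed
  show ?thesis
  proof (rule ex1I[of _ t])
    show "t > 0 \<and> t ^ 4 - t ^ 3 - 1 = 0" using t by auto
    show "x = t" if "x > 0 \<and> x ^ 4 - x ^ 3 - 1 = 0" for x
      by (rule linorder_cases[of x t]) (use less[of x t] less[of t x] that t in auto)
  qed
qed

end

theory Submission
  imports Defs "HOL-Real_Asymp.Real_Asymp"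
begin

text \<open>
  Put \<open>u = 1/\<theta>\<close>, so that \<open>1 - u = u\<^sup>4\<close>. Duplication for \<open>u\<^sup>1\<^sup>4\<close> and \<open>u\<^sup>4\<close> together with the
  reflection \<open>Li2 u + Li2 (1 - u)\<close> reduces the ladder to the evaluation of
  \<open>Li2 (u\<^sup>5) + Li2 (-u\<^sup>2) - Li2 (-u\<^sup>7)\<close>. This is the left-hand side of Abel's five-term relation at
  \<open>x = u\<^sup>5\<close>, \<open>y = -u\<^sup>2\<close>, whose right-hand side has the dilogarithm arguments \<open>u\<^sup>4\<close> and \<open>-u\<^sup>3\<close>;
  since \<open>-u\<^sup>3 = u\<^sup>4 / (u\<^sup>4 - 1)\<close>, Landen's relation evaluates their sum as \<open>-ln\<^sup>2 u / 2\<close>.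
\<close>

section \<open>Analytic basics: special values, continuity, derivative\<close>

lemma Li2_0 [simp]: "Li2 (0 :: 'a :: {real_normed_field, banach}) = 0"
  by (simp add: Li2_def)

lemma Li2_1: "Li2 (1 :: real) = pi ^ 2 / 6"
  using sums_unique2[OF Li2_sums[of "1 :: real"]] inverse_squares_sums by (simp add: add.commute)

text \<open>The majorant \<open>1 / (n + 1)^2\<close> is independent of the point, so continuity
  reaches the boundary of the disc; the reflection formula needs it at 1.\<close>

lemma continuous_on_Li2: "continuous_on (cball 0 1) (Li2 :: 'a :: {real_normed_field, banach} \<Rightarrow> 'a)"
proof -
  have "uniform_limit (cball 0 1) (\<lambda>n x. \<Sum>i<n. x ^ Suc i / of_nat (Suc i) ^ 2)
          (\<lambda>x :: 'a. \<Sum>i. x ^ Suc i / of_nat (Suc i) ^ 2) sequentially"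
  proof (rule Weierstrass_m_test)
    show "summable (\<lambda>n. 1 / real (Suc n) ^ 2)"
      using Li2_sums[of "1 :: real"] by (simp add: sums_iff)
    fix n :: nat and x :: 'a
    assume "x \<in> cball 0 1"
    then have "norm x ^ Suc n \<le> 1"
      by (intro power_le_one) auto
    then show "norm (x ^ Suc n / of_nat (Suc n) ^ 2) \<le> 1 / real (Suc n) ^ 2"
      by (simp only: norm_divide norm_power norm_of_nat) (rule divide_right_mono, auto)
  qed
  then have "continuous_on (cball 0 1) (\<lambda>x :: 'a. \<Sum>i. x ^ Suc i / of_nat (Suc i) ^ 2)"
    by (rule uniform_limit_theorem[rotated])
       (auto intro!: always_eventually continuous_intros simp del: of_nat_Suc)
  then show ?thesis
    by (simp add: Li2_def[abs_def])
qed

lemma continuous_on_Li2_compose [continuous_intros]: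
  fixes f :: "'b :: topological_space \<Rightarrow> 'a :: {real_normed_field, banach}"
  assumes "continuous_on S f" and "\<And>x. x \<in> S \<Longrightarrow> norm (f x) \<le> 1"
  shows "continuous_on S (\<lambda>x. Li2 (f x))"
  by (rule continuous_on_compose2[OF continuous_on_Li2 assms(1)]) (use assms(2) in auto)

lemma has_real_derivative_Li2:
  fixes x :: real
  assumes "\<bar>x\<bar> < 1" and "x \<noteq> 0"
  shows "(Li2 has_real_derivative - ln (1 - x) / x) (at x)"
proof -
  \<comment> \<open>Division by zero makes \<open>c 0 = 0\<close>, so this power series, indexed
    from 0, has the same sum as the shifted one. The logarithm series below has a zero term at index
    0 for the same reason.\<close>
  define c :: "nat \<Rightarrow> real" where "c n = 1 / real n ^ 2" for n
  have sums_c: "(\<lambda>n. c n * z ^ n) sums Li2 z" if "\<bar>z\<bar> \<le> 1" for z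
    using Li2_sums[of z] that sums_Suc[of "\<lambda>n. c n * z ^ n" "Li2 z"]
    by (simp add: c_def)
  have "((\<lambda>z. \<Sum>n. c n * z ^ n) has_real_derivative (\<Sum>n. diffs c n * x ^ n)) (at x)"
    by (rule termdiffs_strong[of c 1]) (use sums_c[of 1] assms in \<open>auto simp: sums_iff\<close>)
  then have deriv: "(Li2 has_real_derivative (\<Sum>n. diffs c n * x ^ n)) (at x)"
    by (rule has_field_derivative_transform_within_open[of _ _ _ "{-1<..<1}"])
       (use assms in \<open>auto intro!: sums_unique[symmetric] sums_c\<close>)
  have "(\<lambda>n. - (x ^ n) / real n) sums ln (1 - x)"
    using ln_series'[of "- x"] assms by simp
  then have "(\<lambda>n. - (x ^ Suc n) / real (Suc n)) sums ln (1 - x)"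
    by (subst sums_Suc_iff) simp
  then have "(\<lambda>n. (- 1 / x) * (- (x ^ Suc n) / real (Suc n))) sums ((- 1 / x) * ln (1 - x))"
    by (rule sums_mult)
  moreover have "(- 1 / x) * (- (x ^ Suc n) / real (Suc n)) = diffs c n * x ^ n" for n
    using assms by (simp add: diffs_def c_def power2_eq_square field_simps del: of_nat_Suc)
  ultimately have "(\<Sum>n. diffs c n * x ^ n) = - ln (1 - x) / x"
    by (simp add: sums_iff)
  with deriv show ?thesis by simp
qed

lemmas has_real_derivative_Li2_compose [derivative_intros] =
  DERIV_chain2[OF has_real_derivative_Li2]

section \<open>Functional equations, each by differentiation\<close>

lemma Li2_square:
  fixes x :: real
  assumes "0 < x" "x < 1"
  shows "Li2 (x ^ 2) = 2 * Li2 x + 2 * Li2 (- x)"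
proof -
  define f where "f = (\<lambda>z :: real. Li2 (z ^ 2) - 2 * Li2 z - 2 * Li2 (- z))"
  have "f x = f 0"
  proof (rule DERIV_isconst2[of 0 x])
    show "continuous_on {0..x} f"
      unfolding f_def using assms
      by (intro continuous_intros) (auto simp: power_le_one)
    fix z assume z: "0 < z" "z < x"
    have "z ^ 2 < 1"
      using z assms by (simp add: power_less_one_iff)
    moreover have "1 - z ^ 2 = (1 - z) * (1 + z)"
      by (simp add: algebra_simps power2_eq_square)
    then have "ln (1 - z ^ 2) = ln (1 - z) + ln (1 + z)"
      using z assms by (simp add: ln_mult)
    ultimately show "DERIV f z :> 0"
      unfolding f_def using z assms
      by (auto intro!: derivative_eq_intros simp: field_simps power2_eq_square)
  qed (use assms in auto)
  then show ?thesis
    by (simp add: f_def)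
qed

text \<open>The derivatives cancel, but \<open>ln\<close> is singular at 0, so the constant is found
  as a limit from the right: \<open>ln z * ln (1 - z)\<close> tends to 0 and
  \<open>Li2 (1 - z)\<close> to \<open>Li2 1\<close>.\<close>

lemma Li2_reflection:
  fixes x :: real
  assumes "0 < x" "x < 1"
  shows "Li2 x + Li2 (1 - x) = pi ^ 2 / 6 - ln x * ln (1 - x)"
proof -
  define f where "f = (\<lambda>z :: real. Li2 z + Li2 (1 - z) + ln z * ln (1 - z))"
  have const: "f z = f x" if "0 < z" "z < x" for z
  proof -
    have "f x = f z"
    proof (rule DERIV_isconst2[of z x])
      show "continuous_on {z..x} f"
        unfolding f_def using that assms by (intro continuous_intros) auto
      show "DERIV f w :> 0" if "z < w" "w < x" for w
        unfolding f_def using that \<open>0 < z\<close> assms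
        by (auto intro!: derivative_eq_intros)
    qed (use that in auto)
    then show ?thesis ..
  qed
  have "((\<lambda>z :: real. ln z * ln (1 - z)) \<longlongrightarrow> 0) (at_right 0)"
    by real_asymp
  moreover have "continuous_on {0..1 :: real} (\<lambda>z. Li2 z + Li2 (1 - z))"
    by (intro continuous_intros) auto
  then have "((\<lambda>z :: real. Li2 z + Li2 (1 - z)) \<longlongrightarrow> Li2 0 + Li2 (1 - 0)) (at_right 0)"
    by (rule continuous_on_Icc_at_rightD) simp
  ultimately have "(f \<longlongrightarrow> Li2 0 + Li2 (1 - 0) + 0) (at_right 0)"
    unfolding f_def by (rule tendsto_add[rotated])
  moreover have "\<forall>\<^sub>F z in at_right 0. f z = f x"
    using eventually_at_right_real[OF assms(1)] by eventually_elim (use const in auto)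
  then have "(f \<longlongrightarrow> f x) (at_right 0)"
    by (rule tendsto_eventually)
  ultimately have "f x = Li2 0 + Li2 (1 - 0) + 0"
    by (intro tendsto_unique[OF trivial_limit_at_right_real])
  then show ?thesis
    by (simp add: f_def Li2_1)
qed

text \<open>The derivatives cancel because \<open>1 - z / (z - 1)\<close> is the inverse of
  \<open>1 - z\<close>. The bound \<open>1 / 2\<close> keeps \<open>x / (x - 1)\<close> inside the
  unit disc.\<close>

lemma Li2_landen:
  fixes x :: real
  assumes "0 < x" "x < 1 / 2"
  shows "Li2 x + Li2 (x / (x - 1)) = - (ln (1 - x) ^ 2) / 2"
proof -
  define f where "f = (\<lambda>z :: real. Li2 z + Li2 (z / (z - 1)) + ln (1 - z) ^ 2 / 2)"
  have bound: "\<bar>z / (z - 1)\<bar> < 1" if "0 \<le> z" "z \<le> x" for z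
    using that assms by (simp add: abs_divide divide_less_eq)
  have "f x = f 0"
  proof (rule DERIV_isconst2[of 0 x])
    show "continuous_on {0..x} f"
      unfolding f_def using assms
      by (intro continuous_intros) (auto intro: less_imp_le[OF bound])
    fix z assume z: "0 < z" "z < x"
    have "1 - z / (z - 1) = inverse (1 - z)"
      using z assms by (simp add: field_simps)
    then have "ln (1 - z / (z - 1)) = - ln (1 - z)"
      using z assms by (simp add: ln_inverse)
    then show "DERIV f z :> 0"
      unfolding f_def using z assms bound[of z]
      by (auto intro!: derivative_eq_intros) (simp add: divide_simps, simp add: algebra_simps)
  qed (use assms in auto)
  then show ?thesis
    by (simp add: f_def)
qed

text \<open>Abel's relation for \<open>y\<close> of negative sign: with \<open>y\<close> fixed, the
  difference of the two sides has derivative 0 in \<open>x\<close> and vanishes at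
  \<open>x = 0\<close>.\<close>

lemma Li2_five_term:
  fixes x y :: real
  assumes x: "0 < x" "x < 1" and y: "-1 < y" "y < 0"
  shows "Li2 x + Li2 y - Li2 (x * y) =
           Li2 (x * (1 - y) / (1 - x * y)) + Li2 (y * (1 - x) / (1 - x * y))
           + ln ((1 - x) / (1 - x * y)) * ln ((1 - y) / (1 - x * y))"
proof -
  define f where "f = (\<lambda>z. Li2 z + Li2 y - Li2 (z * y)
           - Li2 (z * (1 - y) / (1 - z * y)) - Li2 (y * (1 - z) / (1 - z * y))
           - (ln (1 - z) - ln (1 - z * y)) * (ln (1 - y) - ln (1 - z * y)))"
  \<comment> \<open>As \<open>y\<close> lies in \<open>(-1, 0)\<close>, the denominator
    \<open>1 - z * y\<close> is at least 1 and \<open>z * y\<close> stays in the unit disc.\<close>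
  have prod: "0 \<le> - (z * y)" "- (z * y) \<le> z" if "0 \<le> z" for z
    using that y mult_left_mono[of "- y" 1 z] by (auto simp: mult_nonneg_nonpos)
  \<comment> \<open>These complements are what \<open>ln\<close> is applied to in the derivatives;
    as quotients they split into differences of three logarithms.\<close>
  have A: "1 - z * (1 - y) / (1 - z * y) = (1 - z) / (1 - z * y)"
    and B: "1 - y * (1 - z) / (1 - z * y) = (1 - y) / (1 - z * y)" if "0 \<le> z" for z
    using prod[OF that] by (simp_all add: field_simps)
  have absA: "\<bar>z * (1 - y) / (1 - z * y)\<bar> < 1"
    and absB: "\<bar>y * (1 - z) / (1 - z * y)\<bar> < 1" if z: "0 \<le> z" "z \<le> x" for z
  proof -
    have "0 < (1 - z) / (1 - z * y)" "0 \<le> z * (1 - y) / (1 - z * y)"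
      using z prod[OF z(1)] x y by auto
    then show "\<bar>z * (1 - y) / (1 - z * y)\<bar> < 1"
      using A[OF z(1)] by linarith
    have "0 < 1 - z * y"
      using prod(1)[OF z(1)] by linarith
    moreover have "y * (1 - z) \<le> 0"
      using z x y by (simp add: mult_le_0_iff)
    moreover have "- (1 - z * y) < y * (1 - z)"
      using prod[OF z(1)] y by (simp add: algebra_simps)
    ultimately have "y * (1 - z) / (1 - z * y) \<le> 0" "-1 < y * (1 - z) / (1 - z * y)"
      by (simp_all add: pos_less_divide_eq divide_le_0_iff)
    then show "\<bar>y * (1 - z) / (1 - z * y)\<bar> < 1"
      by linarith
  qed
  have "f x = f 0"
  proof (rule DERIV_isconst2[of 0 x])
    have absP: "\<bar>z * y\<bar> \<le> 1" if "0 \<le> z" "z \<le> x" for z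
      using prod[OF that(1)] that x by linarith
    have pos: "1 - z * y > 0" if "0 \<le> z" for z
      using prod[OF that] by linarith
    have side: "norm (z * (1 - y) / (1 - z * y)) \<le> 1" "norm (y * (1 - z) / (1 - z * y)) \<le> 1"
      "norm (z * y) \<le> 1" "1 - z * y \<noteq> 0" "1 - z \<noteq> 0" "norm z \<le> 1" if "z \<in> {0..x}" for z
      using absA[of z] absB[of z] absP[of z] pos[of z] that x by simp_all
    show "continuous_on {0..x} f"
      unfolding f_def by (intro continuous_intros ballI side; assumption)
    fix z assume z: "0 < z" "z < x"
    define a b c where "a = ln (1 - z)" and "b = ln (1 - y)" and "c = ln (1 - z * y)"
    have "ln (1 - z * (1 - y) / (1 - z * y)) = a - c" "ln (1 - y * (1 - z) / (1 - z * y)) = b - c"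
      using z x y pos[of z] by (simp_all add: A B ln_div a_def b_def c_def)
    note logs = this
    have P: "\<bar>z * y\<bar> < 1"
      using prod[of z] z x by linarith
    define d where "d = 1 - z * y"
    have d: "d \<noteq> 0"
      using pos[of z] z by (simp add: d_def)
    have nz: "z \<noteq> 0" "1 - z \<noteq> 0" "y \<noteq> 0" "1 - y \<noteq> 0"
      using z x y by auto
    have "((\<lambda>z. z * (1 - y) / (1 - z * y)) has_real_derivative (1 - y) / d ^ 2) (at z)"
      using d by (auto intro!: derivative_eq_intros simp: d_def power2_eq_square algebra_simps)
    from has_real_derivative_Li2_compose[OF absA _ this, unfolded logs]
    have DA: "((\<lambda>z. Li2 (z * (1 - y) / (1 - z * y))) has_real_derivative - (a - c) / (z * d)) (at z)"
      by (rule DERIV_cong)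
         (use z nz d in \<open>simp_all flip: d_def, simp add: power2_eq_square divide_simps\<close>)
    have "((\<lambda>z. y * (1 - z) / (1 - z * y)) has_real_derivative - (y * (1 - y)) / d ^ 2) (at z)"
      using d by (auto intro!: derivative_eq_intros simp: d_def power2_eq_square algebra_simps)
    from has_real_derivative_Li2_compose[OF absB _ this, unfolded logs]
    have DB: "((\<lambda>z. Li2 (y * (1 - z) / (1 - z * y))) has_real_derivative
                (b - c) * (1 - y) / ((1 - z) * d)) (at z)"
      by (rule DERIV_cong)
         (use z nz d in \<open>simp_all flip: d_def, simp add: power2_eq_square divide_simps,
                 simp add: algebra_simps\<close>)
    have "((\<lambda>z. z * y) has_real_derivative y) (at z)"
      by (auto intro!: derivative_eq_intros)
    from has_real_derivative_Li2_compose[OF P _ this]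
    have DP: "((\<lambda>z. Li2 (z * y)) has_real_derivative - c / z) (at z)"
      by (rule DERIV_cong) (use nz in \<open>simp_all add: c_def\<close>)
    have DL: "((\<lambda>z. (ln (1 - z) - ln (1 - z * y)) * (ln (1 - y) - ln (1 - z * y)))
                has_real_derivative (y / d - 1 / (1 - z)) * (b - c) + (a - c) * (y / d)) (at z)"
      using z x pos[of z] by (auto intro!: derivative_eq_intros simp: a_def b_def c_def d_def)
    have D1: "(Li2 has_real_derivative - a / z) (at z)"
      unfolding a_def using z x by (intro has_real_derivative_Li2) auto
    have "DERIV f z :> - a / z + 0 - - c / z - - (a - c) / (z * d)
            - (b - c) * (1 - y) / ((1 - z) * d)
            - ((y / d - 1 / (1 - z)) * (b - c) + (a - c) * (y / d))"
      unfolding f_def by (intro DERIV_diff DERIV_add DERIV_const DA DB DP DL D1)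
    moreover have "- a / z + 0 - - c / z - - (a - c) / (z * d)
            - (b - c) * (1 - y) / ((1 - z) * d)
            - ((y / d - 1 / (1 - z)) * (b - c) + (a - c) * (y / d)) = 0"
    proof -
      \<comment> \<open>Partial fractions from \<open>d = 1 - z * y\<close>; afterwards the
        cancellation is linear in the remaining quotients.\<close>
      have "y / d - 1 / (1 - z) = - ((1 - y) / ((1 - z) * d))"
        using nz d by (simp add: divide_simps) (simp add: d_def algebra_simps)
      then have "(y / d - 1 / (1 - z)) * (b - c) = - ((b - c) * (1 - y) / ((1 - z) * d))"
        by (simp only:) simp
      moreover have "y / d = 1 / (z * d) - 1 / z"
        using nz d by (simp add: divide_simps) (simp add: d_def algebra_simps)
      then have "(a - c) * (y / d) = (a - c) / (z * d) - a / z + c / z"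
        by (simp only:) (simp add: right_diff_distrib diff_divide_distrib)
      moreover have "- (a - c) / (z * d) = - ((a - c) / (z * d))"
        "- a / z = - (a / z)" "- c / z = - (c / z)"
        by (simp_all only: minus_divide_left)
      ultimately show ?thesis
        by linarith
    qed
    ultimately show "DERIV f z :> 0"
      by simp
  qed (use x in auto)
  moreover have "f 0 = 0"
    by (simp add: f_def)
  moreover have "1 - x * y > 0"
    using prod[of x] x by linarith
  ultimately show ?thesis
    using x y by (simp add: f_def ln_div)
qed

section \<open>The ladder at \<open>u = 1 / \<theta>\<close>\<close>

theorem theorem21:
  fixes \<theta> :: real
  assumes "\<theta> > 0" and "\<theta> ^ 4 - \<theta> ^ 3 - 1 = 0"
  shows "Li2 (1 / \<theta> ^ 14) - 2 * Li2 (1 / \<theta> ^ 7) - 2 * Li2 (1 / \<theta> ^ 5)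
           + Li2 (1 / \<theta> ^ 4) + 2 * Li2 (1 / \<theta> ^ 2) + 2 * Li2 (1 / \<theta>)
         = pi ^ 2 / 3 - 5 * (ln (1 / \<theta>)) ^ 2"
proof -
  define u where "u = 1 / \<theta>"
  have u_pow: "1 / \<theta> ^ n = u ^ n" for n
    by (simp add: u_def power_one_over)
  have "u > 0"
    using assms(1) by (simp add: u_def)
  have u4: "u ^ 4 = 1 - u"
  proof -
    have "u * \<theta> = 1"
      using assms(1) by (simp add: u_def)
    with assms(2) show ?thesis by algebra
  qed
  have "u < 1"
    using u4 \<open>u > 0\<close> zero_less_power[of u 4] by linarith
  \<comment> \<open>This gives \<open>u ^ 4 = 1 - u < 1 / 2\<close>, the range of Landen's
    relation.\<close>
  have "u > 1 / 2"
  proof (rule ccontr)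
    assume "\<not> u > 1 / 2"
    then have "u ^ 4 \<le> (1 / 2) ^ 4" "u \<le> 1 / 2"
      using \<open>u > 0\<close> by (auto intro: power_mono)
    with u4 show False by (simp add: power_numeral_reduce)
  qed
  have less_1: "u ^ n < 1" if "n > 0" for n
    using that \<open>u > 0\<close> \<open>u < 1\<close> by (simp add: power_less_one_iff)
  define L where "L = ln u"
  \<comment> \<open>Here \<open>u ^ 7 = u ^ 3 - u ^ 4 = u ^ 3 + u - 1\<close>. So the five-term
    denominator \<open>1 + u ^ 7\<close> factors as \<open>u * (1 + u ^ 2)\<close>, which collapses
    the four quotients below to powers of \<open>u\<close>.\<close>
  have u7: "1 + u ^ 7 = u + u ^ 3"
    using u4 by algebra
  have nz: "1 + u ^ 7 \<noteq> 0"
    using zero_less_power[OF \<open>u > 0\<close>, of 7] by linarith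
  have A: "u ^ 5 * (1 + u ^ 2) / (1 + u ^ 7) = u ^ 4"
  proof -
    have "u ^ 5 * (1 + u ^ 2) = u ^ 4 * (1 + u ^ 7)"
      unfolding u7 by (simp add: algebra_simps power_numeral_reduce)
    then show ?thesis by (simp only: nonzero_divide_eq_eq[OF nz])
  qed
  have B: "- (u ^ 2) * (1 - u ^ 5) / (1 + u ^ 7) = - (u ^ 3)"
  proof -
    have "u ^ 2 * (1 - u ^ 5) = u ^ 3 * (1 + u ^ 7)"
      using u4 by algebra
    then show ?thesis using nz by (simp add: divide_eq_eq)
  qed
  have lnA: "(1 - u ^ 5) / (1 + u ^ 7) = u"
  proof -
    have "1 - u ^ 5 = u * (1 + u ^ 7)"
      using u4 by algebra
    then show ?thesis by (simp only: nonzero_divide_eq_eq[OF nz])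
  qed
  have lnB: "(1 + u ^ 2) / (1 + u ^ 7) = 1 / u"
  proof -
    have "u * (1 + u ^ 2) = 1 + u ^ 7"
      unfolding u7 by (simp add: algebra_simps power_numeral_reduce)
    then show ?thesis
      using nz \<open>u > 0\<close> by (simp add: frac_eq_eq mult.commute)
  qed
  have "u ^ 5 * - (u ^ 2) = - (u ^ 7)"
    by (simp flip: power_add)
  then have "Li2 (u ^ 5) + Li2 (- (u ^ 2)) - Li2 (- (u ^ 7))
               = Li2 (u ^ 4) + Li2 (- (u ^ 3)) + ln u * ln (1 / u)"
    using Li2_five_term[of "u ^ 5" "- (u ^ 2)"] \<open>u > 0\<close> less_1[of 5] less_1[of 2]
    by (simp only: diff_minus_eq_add A B lnA lnB) simp
  then have "Li2 (u ^ 5) + Li2 (- (u ^ 2)) - Li2 (- (u ^ 7))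
               = Li2 (u ^ 4) + Li2 (- (u ^ 3)) - L ^ 2"
    using \<open>u > 0\<close> by (simp add: L_def ln_div power2_eq_square)
  moreover have "Li2 (u ^ 4) + Li2 (- (u ^ 3)) = - (L ^ 2) / 2"
  proof -
    have "u ^ 4 / (u ^ 4 - 1) = - (u ^ 3)"
      using \<open>u > 0\<close> by (simp add: u4) (simp add: u4[symmetric] power_numeral_reduce)
    moreover have "u ^ 4 < 1 / 2"
      using u4 \<open>u > 1 / 2\<close> by linarith
    moreover have "1 - u ^ 4 = u"
      using u4 by simp
    ultimately show ?thesis
      using Li2_landen[of "u ^ 4"] \<open>u > 0\<close> by (simp add: L_def)
  qed
  \<comment> \<open>The factor 4 is \<open>ln (1 - u) = ln (u ^ 4) = 4 * L\<close>.\<close>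
  moreover have "Li2 u + Li2 (u ^ 4) = pi ^ 2 / 6 - 4 * L ^ 2"
    using Li2_reflection[OF \<open>u > 0\<close> \<open>u < 1\<close>] \<open>u > 0\<close>
    by (simp add: L_def ln_realpow power2_eq_square flip: u4)
  moreover have "Li2 (u ^ 14) = 2 * Li2 (u ^ 7) + 2 * Li2 (- (u ^ 7))"
    using Li2_square[of "u ^ 7"] \<open>u > 0\<close> less_1[of 7] by (simp flip: power_mult)
  moreover have "Li2 (u ^ 4) = 2 * Li2 (u ^ 2) + 2 * Li2 (- (u ^ 2))"
    using Li2_square[of "u ^ 2"] \<open>u > 0\<close> less_1[of 2] by (simp flip: power_mult)
  \<comment> \<open>By the duplications, the left-hand side is twice
    \<open>Li2 u + Li2 (u ^ 4)\<close> minus twice the five-term combination, whose value is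
    \<open>- 3 / 2 * L ^ 2\<close>; the \<open>L ^ 2\<close> coefficient is thus
    \<open>- 8 + 3 = - 5\<close>.\<close>
  ultimately show ?thesis
    unfolding u_pow L_def u_def[symmetric] by argo
qed

end
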